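(* Let $C$ and $D$ be linear endomorphisms of $V$ with $C=-C^*$ and $D=-D^*$, and let $\dim V\ge 3$. If $\{C,D,I\}$ is linearly independent, then $\{R^S_I, R^{\Lambda}_C, R^{\Lambda}_D\}$ is linearly independent.
   Context: $V$ is a finite-dimensional real vector space, $\phi$ a positive definite inner product on $V$, $A^*$ the adjoint of $A$ with respect to $\phi$, and $I$ the identity endomorphism. For an endomorphism $A$ of $V$, $$R^S_{A}(x,y,z,w)= \phi (Ax,w) \phi (Ay,z) - \phi (Ax,z) \phi (Ay,w),$$ $$R^{\Lambda}_{A} (x,y,z,w) =\phi (Ax,w) \phi (Ay,z) - \phi (Ax,z) \phi (Ay,w) -2 \phi (Ax,y) \phi (Az,w).$$ Linear independence of tensors is in the real vector space of multilinear maps $V^4\to\mathbb{R}$; sets are regarded as indexed families. *)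

theory Defs
  imports "HOL-Analysis.Analysis" "HOL-Library.Function_Algebras"
begin

(* Pointwise real vector space structure on functions.  It covers both endomorphisms ('a => 'a)
   and curried tensors ('a => 'a => 'a => 'a => real).  The linear, respectively multilinear, maps
   form a subspace, so linear independence may be tested in the ambient function space. *)

instantiation "fun" :: (type, real_vector) real_vector
begin

definition scaleR_fun :: "real \<Rightarrow> ('a \<Rightarrow> 'b) \<Rightarrow> 'a \<Rightarrow> 'b"
  where "scaleR_fun r f = (\<lambda>x. r *\<^sub>R f x)"

instance
  by standard (auto simp: scaleR_fun_def fun_eq_iff scaleR_add_right scaleR_add_left)

end

lemma scaleR_fun_apply [simp]: "(r *\<^sub>R f) x = r *\<^sub>R f x"
  by (simp add: scaleR_fun_def)

(* Linear independence of a finite indexed family, given as a list: unlike for independent (set vs),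
   a repeated entry makes the family dependent. *)

definition independent_family :: "'v::real_vector list \<Rightarrow> bool"
  where "independent_family vs \<longleftrightarrow>
    (\<forall>c :: nat \<Rightarrow> real. (\<Sum>i<length vs. c i *\<^sub>R vs ! i) = 0 \<longrightarrow> (\<forall>i<length vs. c i = 0))"

lemma independent_family_iff: "independent_family vs \<longleftrightarrow> distinct vs \<and> independent (set vs)"
proof
  assume ind: "independent_family vs"
  have "distinct vs"
  proof (rule ccontr)
    assume "\<not> distinct vs"
    then obtain i j where ij: "i < length vs" "j < length vs" "i \<noteq> j" "vs ! i = vs ! j"
      by (auto simp: distinct_conv_nth)
    define c :: "nat \<Rightarrow> real" where "c k = (if k = i then 1 else 0) - (if k = j then 1 else 0)" for k
    have "(\<Sum>k<length vs. c k *\<^sub>R vs ! k) =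
        (\<Sum>k<length vs. (if k = i then vs ! k else 0)) - (\<Sum>k<length vs. (if k = j then vs ! k else 0))"
      unfolding sum_subtractf[symmetric] by (rule sum.cong) (auto simp: c_def)
    also have "\<dots> = 0"
      using ij by (simp add: sum.delta)
    finally have "c i = 0"
      using ind ij unfolding independent_family_def by blast
    then show False
      using ij by (simp add: c_def)
  qed
  moreover have "independent (set vs)"
  proof
    assume "dependent (set vs)"
    then obtain u v where u: "(\<Sum>w\<in>set vs. u w *\<^sub>R w) = 0" "v \<in> set vs" "u v \<noteq> 0"
      by (auto simp: dependent_finite)
    have "(\<Sum>i<length vs. u (vs ! i) *\<^sub>R vs ! i) = (\<Sum>w\<in>set vs. u w *\<^sub>R w)"
      by (rule sum.reindex_bij_betw[OF bij_betw_nth[OF \<open>distinct vs\<close> refl refl]])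
    then show False
      using ind u unfolding independent_family_def
      by (metis in_set_conv_nth)
  qed
  ultimately show "distinct vs \<and> independent (set vs)" ..
next
  assume *: "distinct vs \<and> independent (set vs)"
  show "independent_family vs"
    unfolding independent_family_def
  proof (intro allI impI)
    fix c :: "nat \<Rightarrow> real" and i
    assume c: "(\<Sum>i<length vs. c i *\<^sub>R vs ! i) = 0" and i: "i < length vs"
    have bij: "bij_betw ((!) vs) {..<length vs} (set vs)"
      using * by (intro bij_betw_nth) auto
    define u where "u w = c (the_inv_into {..<length vs} ((!) vs) w)" for w
    have u: "u (vs ! k) = c k" if "k < length vs" for k
      using that bij by (simp add: u_def bij_betw_def the_inv_into_f_f)
    have "(\<Sum>w\<in>set vs. u w *\<^sub>R w) = (\<Sum>i<length vs. u (vs ! i) *\<^sub>R vs ! i)"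
      by (rule sum.reindex_bij_betw[OF bij, symmetric])
    also have "\<dots> = 0"
      using c u by simp
    finally have "u (vs ! i) = 0"
      using * nth_mem[OF i] by (auto simp: dependent_finite)
    then show "c i = 0"
      using u i by simp
  qed
qed

(* The inner product phi is the class operation \<bullet>, and adjoint is taken with respect to it. *)

definition RS :: "('a::real_inner \<Rightarrow> 'a) \<Rightarrow> 'a \<Rightarrow> 'a \<Rightarrow> 'a \<Rightarrow> 'a \<Rightarrow> real"
  where "RS A x y z w = (A x \<bullet> w) * (A y \<bullet> z) - (A x \<bullet> z) * (A y \<bullet> w)"

definition RLambda :: "('a::real_inner \<Rightarrow> 'a) \<Rightarrow> 'a \<Rightarrow> 'a \<Rightarrow> 'a \<Rightarrow> 'a \<Rightarrow> real"
  where "RLambda A x y z w =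
    (A x \<bullet> w) * (A y \<bullet> z) - (A x \<bullet> z) * (A y \<bullet> w) - 2 * (A x \<bullet> y) * (A z \<bullet> w)"

end

theory Submission
  imports Defs
begin

text \<open>
  Suppose \<open>a R\<^sup>S\<^sub>I + b R\<^sup>\<Lambda>\<^sub>C + c R\<^sup>\<Lambda>\<^sub>D = 0\<close>. Everything is read off from the sectional values, the values
  at \<open>(x, y, y, x)\<close>. For skew \<open>A\<close> the term \<open>(A x \<bullet> x) (A y \<bullet> y)\<close> vanishes and the other two terms
  coincide up to the factor 2, so the relation becomes
  \<open>a (\<bar>x\<bar>\<^sup>2 \<bar>y\<bar>\<^sup>2 - (x \<bullet> y)\<^sup>2) + 3 b (C x \<bullet> y)\<^sup>2 + 3 c (D x \<bullet> y)\<^sup>2 = 0\<close>.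

  First \<open>a = 0\<close>: some nonzero \<open>x\<close> and \<open>y \<bottom> x\<close> satisfy \<open>C x \<bottom> y\<close> and \<open>D x \<bottom> y\<close>
  (\<open>skew_pair_common_isotropic\<close>). In dimension at least 4 any \<open>x\<close> will do, since \<open>x\<close>, \<open>C x\<close>, \<open>D x\<close>
  do not span the space. In dimension 3 take \<open>x\<close> in the kernel of \<open>C\<close>, which is nonzero because the
  dimension is odd; then \<open>x\<close> and \<open>D x\<close> do not span the space.

  What is left is \<open>b (C x \<bullet> y)\<^sup>2 + c (D x \<bullet> y)\<^sup>2 = 0\<close> for all \<open>x\<close>, \<open>y\<close>. If \<open>b \<noteq> 0\<close>, the form
  \<open>(C x \<bullet> y)\<^sup>2 - s\<^sup>2 (D x \<bullet> y)\<^sup>2\<close> vanishes for some \<open>s\<close> (or else \<open>C = 0\<close>), and it factors into two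
  bilinear forms. One of the factors is zero because a real vector space is not the union of two
  proper subspaces (\<open>linear_zero_cover\<close>), whence \<open>C = \<plusminus>s D\<close>, against independence. By symmetry \<open>c = 0\<close>.
\<close>

lemma independent_family_three_iff:
  fixes u v w :: "'v::real_vector"
  shows "independent_family [u, v, w] \<longleftrightarrow>
    (\<forall>a b c. a *\<^sub>R u + b *\<^sub>R v + c *\<^sub>R w = 0 \<longrightarrow> a = 0 \<and> b = 0 \<and> c = 0)"
proof
  assume ind: "independent_family [u, v, w]"
  show "\<forall>a b c. a *\<^sub>R u + b *\<^sub>R v + c *\<^sub>R w = 0 \<longrightarrow> a = 0 \<and> b = 0 \<and> c = 0"
  proof (intro allI impI)
    fix a b c :: real
    assume eq: "a *\<^sub>R u + b *\<^sub>R v + c *\<^sub>R w = 0"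
    have "\<forall>i<3. ([a, b, c] ! i) = 0"
      using ind[unfolded independent_family_def, rule_format, of "\<lambda>i. [a, b, c] ! i"] eq
      by (simp add: eval_nat_numeral)
    then show "a = 0 \<and> b = 0 \<and> c = 0"
      by (simp add: eval_nat_numeral All_less_Suc)
  qed
next
  assume "\<forall>a b c. a *\<^sub>R u + b *\<^sub>R v + c *\<^sub>R w = 0 \<longrightarrow> a = 0 \<and> b = 0 \<and> c = 0"
  then show "independent_family [u, v, w]"
    unfolding independent_family_def by (simp add: All_less_Suc)
qed

lemma skew_adjoint_inner:
  fixes A :: "'a::euclidean_space \<Rightarrow> 'a"
  assumes "linear A" and "A = - adjoint A"
  shows "A x \<bullet> y = - (A y \<bullet> x)"
proof -
  have "A y = - adjoint A y"
    using fun_cong[OF assms(2), of y] by simp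
  then show ?thesis
    using adjoint_works[OF assms(1), of x y] by (simp add: inner_commute)
qed

lemma RLambda_sectional:
  assumes "\<And>x y. A x \<bullet> y = - (A y \<bullet> x)"
  shows "RLambda A x y y x = 3 * (A x \<bullet> y)\<^sup>2"
proof -
  have "A x \<bullet> x = 0"
    using assms[of x x] by simp
  then show ?thesis
    using assms[of y x] by (simp add: RLambda_def power2_eq_square)
qed

lemma exists_nonzero_orthogonal:
  fixes S :: "'a::euclidean_space set"
  assumes "finite S" and "card S < DIM('a)"
  shows "\<exists>y. y \<noteq> 0 \<and> (\<forall>s\<in>S. s \<bullet> y = 0)"
proof -
  have "dim S < DIM('a)"
    using dim_le_card'[OF assms(1)] assms(2) by linarith
  then obtain y where "y \<noteq> 0" "\<And>s. s \<in> span S \<Longrightarrow> orthogonal y s"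
    using orthogonal_to_subspace_exists by blast
  then show ?thesis
    by (metis inner_commute orthogonal_def span_base)
qed

text \<open>
  A three-dimensional shadow of the fact that skew maps have even rank, obtained without
  determinants. If \<open>C x \<noteq> 0\<close> and \<open>y\<close> is orthogonal to \<open>x\<close> and \<open>C x\<close>, then skewness makes both \<open>C x\<close>
  and \<open>C y\<close> orthogonal to \<open>x\<close> and \<open>y\<close>; so they lie on one line, and some combination of \<open>x\<close> and \<open>y\<close>
  is killed.
\<close>

lemma skew_dim3_kernel:
  fixes C :: "'a::euclidean_space \<Rightarrow> 'a"
  assumes lin: "linear C" and skew: "\<And>x y. C x \<bullet> y = - (C y \<bullet> x)"
    and dim: "DIM('a) = 3"
  obtains k where "k \<noteq> 0" and "C k = 0"
proof -
  obtain x :: 'a where x: "x \<noteq> 0"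
    using exists_nonzero_orthogonal[of "{} :: 'a set"] by auto
  show thesis
  proof (cases "C x = 0")
    case True
    then show thesis using x that by blast
  next
    case False
    have "card {x, C x} < DIM('a)"
      using card_insert_le_m1[of 2 "{C x}" x] dim by auto
    then obtain y where y: "y \<noteq> 0" "x \<bullet> y = 0" "C x \<bullet> y = 0"
      using exists_nonzero_orthogonal[of "{x, C x}"] by auto
    have self: "C u \<bullet> u = 0" for u
      using skew[of u u] by simp
    have yx: "C y \<bullet> x = 0"
      using skew[of x y] y by simp
    \<comment> \<open>\<open>t\<close> makes \<open>z\<close> orthogonal to \<open>C x\<close>; then \<open>x\<close>, \<open>y\<close>, \<open>C x\<close> leave no room for a nonzero \<open>z\<close>\<close>
    define t where "t = (C y \<bullet> C x) / (C x \<bullet> C x)"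
    define z where "z = C y - t *\<^sub>R C x"
    have z: "z \<bullet> x = 0" "z \<bullet> y = 0" "z \<bullet> C x = 0"
      using False y yx by (simp_all add: z_def t_def inner_diff_left self)
    have "z = 0"
    proof (rule ccontr)
      assume nz: "z \<noteq> 0"
      have orth: "pairwise orthogonal {z, x, y, C x}"
        using z y self[of x]
        by (auto simp: pairwise_insert orthogonal_def inner_commute)
      then have "independent {z, x, y, C x}"
        using nz x y False by (intro pairwise_orthogonal_independent) auto
      then have "card {z, x, y, C x} \<le> 3"
        using independent_bound dim by metis
      moreover have "z \<noteq> x" "z \<noteq> y" "z \<noteq> C x" "x \<noteq> y" "x \<noteq> C x" "y \<noteq> C x"
        using z y self[of x] nz x by (auto simp: inner_commute)
      then have "card {z, x, y, C x} = 4"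
        by simp
      ultimately show False by simp
    qed
    then have "C (y - t *\<^sub>R x) = 0"
      by (simp add: z_def linear_diff[OF lin] linear_scale[OF lin])
    moreover have "y - t *\<^sub>R x \<noteq> 0"
    proof
      assume "y - t *\<^sub>R x = 0"
      then have "y \<bullet> y = t * (x \<bullet> y)"
        by (metis eq_iff_diff_eq_0 inner_scaleR_left)
      then show False
        using y by simp
    qed
    ultimately show thesis using that by blast
  qed
qed

lemma skew_pair_common_isotropic:
  fixes C D :: "'a::euclidean_space \<Rightarrow> 'a"
  assumes lin: "linear C" and skew: "\<And>x y. C x \<bullet> y = - (C y \<bullet> x)"
    and dim: "DIM('a) \<ge> 3"
  obtains x y where "x \<noteq> 0" "y \<noteq> 0" "x \<bullet> y = 0" "C x \<bullet> y = 0" "D x \<bullet> y = 0"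
proof -
  show thesis
  proof (cases "DIM('a) = 3")
    case True
    obtain k where k: "k \<noteq> 0" "C k = 0"
      by (rule skew_dim3_kernel[OF lin skew True])
    have "card {k, D k} < DIM('a)"
      using card_insert_le_m1[of 2 "{D k}" k] True by auto
    then obtain y where "y \<noteq> 0" "k \<bullet> y = 0" "D k \<bullet> y = 0"
      using exists_nonzero_orthogonal[of "{k, D k}"] by auto
    then show thesis
      using that[of k y] k by simp
  next
    case False
    obtain x :: 'a where x: "x \<noteq> 0"
      using exists_nonzero_orthogonal[of "{} :: 'a set"] by auto
    have "card {x, C x, D x} \<le> 3"
      by (simp add: card_insert_if)
    then obtain y where "y \<noteq> 0" "x \<bullet> y = 0" "C x \<bullet> y = 0" "D x \<bullet> y = 0"
      using exists_nonzero_orthogonal[of "{x, C x, D x}"] dim False by auto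
    then show thesis
      using that x by blast
  qed
qed

text \<open>
  A real vector space is not the union of two proper subspaces, here the kernels of \<open>f\<close> and \<open>g\<close>:
  the sum of a vector outside the first kernel and one outside the second lies in neither.
\<close>

lemma linear_zero_cover:
  assumes "linear f" and "linear g" and cover: "\<And>x. f x = 0 \<or> g x = 0"
  shows "(\<forall>x. f x = 0) \<or> (\<forall>x. g x = 0)"
proof (rule ccontr)
  assume "\<not> ?thesis"
  then obtain u v where "f u \<noteq> 0" "g v \<noteq> 0" by blast
  moreover from this have "g u = 0" "f v = 0"
    using cover by blast+
  ultimately have "f (u + v) \<noteq> 0" "g (u + v) \<noteq> 0"
    using assms(1,2) by (simp_all add: linear_add)
  then show False
    using cover by blast
qed

text \<open>The same with products of bilinear forms: cover in \<open>y\<close> for each \<open>x\<close>, then in \<open>x\<close>.\<close>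

lemma bilinear_form_product_zero:
  fixes E F :: "'a::real_vector \<Rightarrow> 'b::real_inner"
  assumes "linear E" and "linear F" and prod: "\<And>x y. (E x \<bullet> y) * (F x \<bullet> y) = 0"
  shows "(\<forall>x. E x = 0) \<or> (\<forall>x. F x = 0)"
proof (rule linear_zero_cover[OF assms(1,2)])
  fix x
  have "linear (\<lambda>y. E x \<bullet> y)" "linear (\<lambda>y. F x \<bullet> y)"
    by (simp_all add: bounded_linear.linear bounded_linear_inner_right)
  then have "(\<forall>y. E x \<bullet> y = 0) \<or> (\<forall>y. F x \<bullet> y = 0)"
    using prod[of x] by (intro linear_zero_cover) auto
  then show "E x = 0 \<or> F x = 0"
    by (metis inner_eq_zero_iff)
qed

text \<open>
  If \<open>b \<noteq> 0\<close>, then \<open>C x \<bullet> y\<close> is a fixed multiple of \<open>D x \<bullet> y\<close> up to a sign, which may a priori vary;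
  factoring the difference of squares shows that the sign is constant. Only the first coefficient is
  treated, in the independence hypothesis and in the conclusion, so that exchanging \<open>C\<close> and \<open>D\<close> gives the
  other.
\<close>

lemma squared_forms_coefficient_zero:
  fixes C D :: "'a::real_vector \<Rightarrow> 'b::real_inner"
  assumes lin: "linear C" "linear D"
    and ind: "\<And>p q. (\<And>x. p *\<^sub>R C x + q *\<^sub>R D x = 0) \<Longrightarrow> p = (0::real)"
    and zero: "\<And>x y. b * (C x \<bullet> y)\<^sup>2 + c * (D x \<bullet> y)\<^sup>2 = 0"
  shows "b = 0"
proof (rule ccontr)
  assume b: "b \<noteq> 0"
  define l where "l = - c / b"
  have eq: "(C x \<bullet> y)\<^sup>2 = l * (D x \<bullet> y)\<^sup>2" for x y
    using zero[of x y] b by (simp add: l_def field_simps)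
  show False
  proof (cases "l \<ge> 0")
    case True
    define s where "s = sqrt l"
    have s: "s\<^sup>2 = l"
      using True by (simp add: s_def)
    have "(\<forall>x. C x - s *\<^sub>R D x = 0) \<or> (\<forall>x. C x + s *\<^sub>R D x = 0)"
    proof (rule bilinear_form_product_zero)
      show "linear (\<lambda>x. C x - s *\<^sub>R D x)" "linear (\<lambda>x. C x + s *\<^sub>R D x)"
        using lin by (simp_all add: linear_compose_sub linear_compose_add linear_compose_scale_right)
      fix x y
      have "((C x - s *\<^sub>R D x) \<bullet> y) * ((C x + s *\<^sub>R D x) \<bullet> y)
          = (C x \<bullet> y)\<^sup>2 - s\<^sup>2 * (D x \<bullet> y)\<^sup>2"
        by (simp add: power2_eq_square algebra_simps)
      then show "((C x - s *\<^sub>R D x) \<bullet> y) * ((C x + s *\<^sub>R D x) \<bullet> y) = 0"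
        using eq s by simp
    qed
    then show False
      using ind[of 1 "- s"] ind[of 1 s] by auto
  next
    case False
    have "C x = 0" for x
    proof -
      have "(C x \<bullet> C x)\<^sup>2 \<le> 0"
        using eq[of x "C x"] False by (simp add: mult_nonpos_nonneg)
      then show ?thesis by simp
    qed
    then show False
      using ind[of 1 0] by simp
  qed
qed

theorem theorem4p5:
  fixes C D :: "'a::euclidean_space \<Rightarrow> 'a"
  assumes "linear C" and "linear D"
    and "C = - adjoint C" and "D = - adjoint D"
    and "DIM('a) \<ge> 3"
    and "independent_family [C, D, id]"
  shows "independent_family [RS id, RLambda C, RLambda D]"
  unfolding independent_family_three_iff
proof (intro allI impI)
  fix a b c :: real
  assume rel: "a *\<^sub>R RS id + b *\<^sub>R RLambda C + c *\<^sub>R RLambda D = 0"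
  note skewC = skew_adjoint_inner[OF assms(1,3)]
  note skewD = skew_adjoint_inner[OF assms(2,4)]
  have sect: "a * ((x \<bullet> x) * (y \<bullet> y) - (x \<bullet> y)\<^sup>2) + 3 * b * (C x \<bullet> y)\<^sup>2 + 3 * c * (D x \<bullet> y)\<^sup>2 = 0"
    for x y
  proof -
    have "(a *\<^sub>R RS id + b *\<^sub>R RLambda C + c *\<^sub>R RLambda D) x y y x = 0"
      using rel by simp
    then have "a * RS id x y y x + b * RLambda C x y y x + c * RLambda D x y y x = 0"
      by simp
    then show ?thesis
      unfolding RLambda_sectional[of C, OF skewC] RLambda_sectional[of D, OF skewD]
      by (simp add: RS_def power2_eq_square inner_commute)
  qed
  obtain x y where "x \<noteq> 0" "y \<noteq> 0" "x \<bullet> y = 0" "C x \<bullet> y = 0" "D x \<bullet> y = 0"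
    by (rule skew_pair_common_isotropic[OF assms(1) skewC assms(5)])
  then have a: "a = 0"
    using sect[of x y] by simp
  have ind: "p = 0 \<and> q = 0" if "\<And>x. p *\<^sub>R C x + q *\<^sub>R D x = 0" for p q
  proof -
    have "p *\<^sub>R C + q *\<^sub>R D + 0 *\<^sub>R id = 0"
      using that by (simp add: fun_eq_iff)
    then show ?thesis
      using assms(6) unfolding independent_family_three_iff by blast
  qed
  have forms: "b * (C x \<bullet> y)\<^sup>2 + c * (D x \<bullet> y)\<^sup>2 = 0" for x y
    using sect[of x y] a by simp
  have "b = 0"
    by (rule squared_forms_coefficient_zero[OF assms(1,2) _ forms]) (rule ind[THEN conjunct1])
  moreover have "c = 0"
  proof (rule squared_forms_coefficient_zero[OF assms(2,1)])
    show "p = 0" if "\<And>x. p *\<^sub>R D x + q *\<^sub>R C x = 0" for p q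
      using ind[of q p] that by (simp add: add.commute)
    show "c * (D x \<bullet> y)\<^sup>2 + b * (C x \<bullet> y)\<^sup>2 = 0" for x y
      using forms[of x y] by simp
  qed
  ultimately show "a = 0 \<and> b = 0 \<and> c = 0"
    using a by simp
qed

end
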